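(* Let $\mathcal{A}$ be a Banach algebra and let $a\in\mathcal{A}$. Then the following are equivalent: (1) $a$ has generalized Zhou inverse. (2) There exists $b\in\mathcal{A}$ such that $b=bab$, $ba=ab$ and $a^n-ab\in\sqrt{J(\mathcal{A})}$ for some $n\in\mathbb{N}$. (3) There exists an idempotent $p\in\mathcal{A}$ such that $pa=ap$ and $a^n-p\in\sqrt{J(\mathcal{A})}$ for some $n\in\mathbb{N}$.
   Context: Banach algebras are complex, associative, with identity $1$ (not necessarily commutative). $\mathbb{N}$ denotes the positive integers. $J(\mathcal{A})$ is the Jacobson radical of $\mathcal{A}$ and $\sqrt{J(\mathcal{A})}=\{x\in \mathcal{A} : x^m\in J(\mathcal{A})\text{ for some } m\in\mathbb{N}\}$. For $a\in\mathcal{A}$, $comm(a)=\{x\in \mathcal{A}: xa=ax\}$ and $comm^2(a)=\{x\in \mathcal{A}: xy=yx\text{ for all }y\in comm(a)\}$. An element $a\in\mathcal{A}$ has generalized Zhou inverse if there exists $b\in\mathcal{A}$ such that $b=bab$, $b\in comm^2(a)$ and $a^n-ab\in\sqrt{J(\mathcal{A})}$ for some $n\in\mathbb{N}$. *)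

theory Defs
  imports "HOL-Analysis.Analysis"
begin

text \<open>
  Complex unital Banach algebras.  The library has only real normed algebras, so the complex
  scalar multiplication is added here as an extension of the real one.  The unit comes from
  \<open>monoid_mult\<close> rather than from \<open>real_normed_algebra_1\<close> because the latter
  would impose \<open>norm 1 = 1\<close> and \<open>0 \<noteq> 1\<close>.
\<close>

class complex_banach_algebra = real_normed_algebra + monoid_mult + banach +
  fixes scaleC :: "complex \<Rightarrow> 'a \<Rightarrow> 'a"  (infixr \<open>*\<^sub>C\<close> 75)
  assumes scaleC_of_real: "complex_of_real r *\<^sub>C x = r *\<^sub>R x"
    and scaleC_add_right: "c *\<^sub>C (x + y) = c *\<^sub>C x + c *\<^sub>C y"
    and scaleC_add_left: "(c + d) *\<^sub>C x = c *\<^sub>C x + d *\<^sub>C x"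
    and scaleC_scaleC: "c *\<^sub>C (d *\<^sub>C x) = (c * d) *\<^sub>C x"
    and scaleC_mult_left: "(c *\<^sub>C x) * y = c *\<^sub>C (x * y)"
    and scaleC_mult_right: "x * (c *\<^sub>C y) = c *\<^sub>C (x * y)"
    and norm_scaleC: "norm (c *\<^sub>C x) = cmod c * norm x"

instantiation complex :: complex_banach_algebra
begin

definition scaleC_complex :: "complex \<Rightarrow> complex \<Rightarrow> complex" where
  "scaleC_complex c x = c * x"

instance
  by standard
    (simp_all add: scaleC_complex_def scaleR_conv_of_real algebra_simps norm_mult)

end

definition left_ideal :: "'a::{ring, monoid_mult} set \<Rightarrow> bool" where
  "left_ideal I \<longleftrightarrow>
     0 \<in> I \<and> (\<forall>x\<in>I. \<forall>y\<in>I. x + y \<in> I) \<and> (\<forall>r. \<forall>x\<in>I. r * x \<in> I)"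

definition maximal_left_ideal :: "'a::{ring, monoid_mult} set \<Rightarrow> bool" where
  "maximal_left_ideal M \<longleftrightarrow>
     left_ideal M \<and> M \<noteq> UNIV \<and> (\<forall>I. left_ideal I \<and> M \<subseteq> I \<longrightarrow> I = M \<or> I = UNIV)"

definition jacobson_radical :: "'a::{ring, monoid_mult} set" where
  "jacobson_radical = \<Inter> {M. maximal_left_ideal M}"

definition sqrt_jacobson :: "'a::{ring, monoid_mult} set" where
  "sqrt_jacobson = {x. \<exists>m::nat. m \<ge> 1 \<and> x ^ m \<in> jacobson_radical}"

definition comm :: "'a::{ring, monoid_mult} \<Rightarrow> 'a set" where
  "comm a = {x. x * a = a * x}"

definition comm2 :: "'a::{ring, monoid_mult} \<Rightarrow> 'a set" where
  "comm2 a = {x. \<forall>y\<in>comm a. x * y = y * x}"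

definition has_generalized_Zhou_inverse :: "'a::{ring, monoid_mult} \<Rightarrow> bool" where
  "has_generalized_Zhou_inverse a \<longleftrightarrow>
     (\<exists>b. b = b * a * b \<and> b \<in> comm2 a \<and>
          (\<exists>n::nat. n \<ge> 1 \<and> a ^ n - a * b \<in> sqrt_jacobson))"

end

theory Submission
  imports Defs
begin

text \<open>
  The implication from (1) to (2) holds because \<open>a\<close> commutes with itself, and the one from (2) to
  (3) is witnessed by \<open>p = ab\<close>.  The content is that (3) implies (1).

  Put \<open>w = a\<^sup>n - p\<close>, an element of \<open>\<surd>J\<close> commuting with \<open>a\<close> and \<open>p\<close>.  Some power of every
  scalar multiple of \<open>w\<close> lies in \<open>J\<close>, so \<open>1 - \<lambda>w\<close> is a unit for every complex \<open>\<lambda>\<close>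
  (\<open>sqrt_jacobson_resolvent\<close>).  In particular \<open>1 + w\<close> has an inverse \<open>v\<close>; since
  \<open>a\<^sup>n p = (1 + w) p\<close>, the element \<open>b = a\<^sup>n\<^sup>-\<^sup>1 p v\<close> satisfies \<open>ab = p\<close> and \<open>pb = b\<close>, hence \<open>b = bab\<close>
  and \<open>a\<^sup>n - ab = w\<close>.

  What remains is that \<open>b\<close> lies in the double commutant of \<open>a\<close>, which reduces to the same claim for
  \<open>p\<close>.  This is where completeness and the complex scalars enter.  An element whose resolvent
  \<open>(1 - \<lambda>w)\<^sup>-\<^sup>1\<close> exists for all complex \<open>\<lambda>\<close> is quasinilpotent, meaning \<open>R\<^sup>k \<parallel>w\<^sup>k\<parallel> \<rightarrow> 0\<close> for
  every \<open>R > 0\<close> (\<open>quasinilpotent_if_resolvent_entire\<close>).  If \<open>y\<close> commutes with \<open>a\<close>, the corner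
  \<open>z = p y (1 - p)\<close> satisfies \<open>z = d z w\<close> with \<open>d = v p\<close>, because \<open>a\<^sup>n\<close> acts invertibly on the
  \<open>p\<close>-side with inverse \<open>d\<close> and as \<open>w\<close> on the \<open>(1 - p)\<close>-side.  Iterating,
  \<open>z = d\<^sup>k z w\<^sup>k\<close> for all \<open>k\<close>, and quasinilpotence forces \<open>z = 0\<close>.  The other corner vanishes
  symmetrically, so \<open>p y = y p\<close> (\<open>spectral_idempotent_commute\<close>).

  Quasinilpotence is obtained without vector-valued complex analysis: averaging the resolvent over
  roots of unity gives \<open>(1 - c\<^sup>n x\<^sup>n)\<^sup>-\<^sup>1\<close>, and the Lipschitz continuity of the resolvent on a disc,
  uniform in \<open>n\<close>, carries the convergence of \<open>r\<^sup>n x\<^sup>n\<close> to zero from \<open>r = 0\<close> to any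
  radius in finitely many steps of fixed length.
\<close>

section \<open>Units from the Jacobson radical\<close>

text \<open>
  The zero algebra, where \<open>0 = 1\<close>, is included here, so units are described in the multiplicative
  monoid alone.
\<close>

definition is_unit_elt :: "'a::monoid_mult \<Rightarrow> bool" where
  "is_unit_elt x \<longleftrightarrow> (\<exists>y. y * x = 1 \<and> x * y = 1)"

lemma left_ideal_UNIV_iff:
  fixes I :: "'a::{ring, monoid_mult} set"
  assumes "left_ideal I"
  shows "I = UNIV \<longleftrightarrow> 1 \<in> I"
  using assms unfolding left_ideal_def by (metis UNIV_I UNIV_eq_I mult.right_neutral)

text \<open>Krull's argument: Zorn's lemma applied to the left ideals above \<open>I\<close> that avoid \<open>1\<close>.\<close>

lemma proper_left_ideal_in_maximal:
  fixes I :: "'a::{ring, monoid_mult} set"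
  assumes I: "left_ideal I" and one: "1 \<notin> I"
  shows "\<exists>M. maximal_left_ideal M \<and> I \<subseteq> M"
proof -
  define A where "A = {K. left_ideal K \<and> I \<subseteq> K \<and> 1 \<notin> K}"
  have "\<exists>M\<in>A. \<forall>X\<in>A. M \<subseteq> X \<longrightarrow> X = M"
  proof (rule subset_Zorn_nonempty)
    show "A \<noteq> {}" using I one unfolding A_def by blast
    fix C assume ne: "C \<noteq> {}" and ch: "subset.chain A C"
    have CA: "\<And>K. K \<in> C \<Longrightarrow> left_ideal K \<and> I \<subseteq> K \<and> 1 \<notin> K"
      using ch unfolding subset.chain_def A_def by blast
    have add: "x + y \<in> \<Union>C" if xy: "x \<in> \<Union>C" "y \<in> \<Union>C" for x y
    proof -
      obtain X Y where XY: "X \<in> C" "x \<in> X" "Y \<in> C" "y \<in> Y" using xy by blast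
      have "X \<subseteq> Y \<or> Y \<subseteq> X" using ch XY(1,3) unfolding subset.chain_def by blast
      then obtain Z where "Z \<in> C" "x \<in> Z" "y \<in> Z" using XY by blast
      then show ?thesis using CA unfolding left_ideal_def by blast
    qed
    have "left_ideal (\<Union>C)"
      unfolding left_ideal_def
    proof (intro conjI ballI allI)
      show "0 \<in> \<Union>C" using ne CA unfolding left_ideal_def by blast
      show "r * x \<in> \<Union>C" if "x \<in> \<Union>C" for r x
        using that CA unfolding left_ideal_def by blast
    qed (rule add)
    then show "\<Union>C \<in> A" using ne CA unfolding A_def by blast
  qed
  then obtain M where M: "M \<in> A" and max: "\<And>X. X \<in> A \<Longrightarrow> M \<subseteq> X \<Longrightarrow> X = M" by blast
  have "K = M \<or> K = UNIV" if K: "left_ideal K" "M \<subseteq> K" for K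
    using K M max[of K] left_ideal_UNIV_iff[OF K(1)] unfolding A_def by blast
  then have "maximal_left_ideal M"
    using M unfolding maximal_left_ideal_def A_def by blast
  then show ?thesis using M unfolding A_def by blast
qed

lemma jacobson_radical_mult_left:
  fixes x :: "'a::{ring, monoid_mult}"
  assumes "x \<in> jacobson_radical"
  shows "r * x \<in> jacobson_radical"
  unfolding jacobson_radical_def
proof (intro InterI)
  fix M :: "'a set" assume M: "M \<in> {M. maximal_left_ideal M}"
  then have "x \<in> M" using assms unfolding jacobson_radical_def by blast
  moreover have "left_ideal M" using M unfolding maximal_left_ideal_def by simp
  ultimately show "r * x \<in> M" unfolding left_ideal_def by simp
qed

text \<open>
  If \<open>1 - x\<close> had no left inverse, the left ideal it generates would lie in a maximal one; that ideal
  also contains \<open>x\<close>, hence \<open>1\<close>.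
\<close>

lemma jacobson_radical_left_inverse:
  fixes x :: "'a::{ring, monoid_mult}"
  assumes x: "x \<in> jacobson_radical"
  shows "\<exists>u. u * (1 - x) = 1"
proof (rule ccontr)
  assume no: "\<not> ?thesis"
  define I where "I = range (\<lambda>u. u * (1 - x))"
  have "left_ideal I"
    unfolding left_ideal_def I_def
  proof (intro conjI ballI allI)
    show "0 \<in> range (\<lambda>u. u * (1 - x))" by (rule range_eqI[of _ _ 0]) simp
  next
    fix a b assume "a \<in> range (\<lambda>u. u * (1 - x))" "b \<in> range (\<lambda>u. u * (1 - x))"
    then obtain u v where "a = u * (1 - x)" "b = v * (1 - x)" by blast
    then show "a + b \<in> range (\<lambda>u. u * (1 - x))"
      by (intro range_eqI[of _ _ "u + v"]) (simp add: distrib_right)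
  next
    fix r a assume "a \<in> range (\<lambda>u. u * (1 - x))"
    then obtain u where "a = u * (1 - x)" by blast
    then show "r * a \<in> range (\<lambda>u. u * (1 - x))"
      by (intro range_eqI[of _ _ "r * u"]) (simp add: mult.assoc)
  qed
  moreover have "1 \<notin> I" using no unfolding I_def by (metis imageE)
  ultimately obtain M where M: "maximal_left_ideal M" "I \<subseteq> M"
    using proper_left_ideal_in_maximal by blast
  have li: "left_ideal M" using M unfolding maximal_left_ideal_def by blast
  have "1 - x \<in> M" using M(2) unfolding I_def by (metis mult_1_left rangeI subsetD)
  moreover have "x \<in> M" using x M(1) unfolding jacobson_radical_def by blast
  ultimately have "(1 - x) + x \<in> M" using li unfolding left_ideal_def by blast
  then have "1 \<in> M" by simp
  then show False using left_ideal_UNIV_iff[OF li] M(1) unfolding maximal_left_ideal_def by blast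
qed

text \<open>
  A left inverse \<open>u\<close> of \<open>1 - x\<close> equals \<open>1 + ux\<close>, where \<open>ux\<close> is again in the radical; so \<open>u\<close> has
  a left inverse too, besides the right inverse \<open>1 - x\<close>, and the two agree.
\<close>

lemma jacobson_radical_unit:
  fixes x :: "'a::{ring, monoid_mult}"
  assumes x: "x \<in> jacobson_radical"
  shows "is_unit_elt (1 - x)"
proof -
  obtain u where u: "u * (1 - x) = 1" using jacobson_radical_left_inverse[OF x] by blast
  have "u * (1 - x) + u * x = u" by (simp add: right_diff_distrib)
  then have "u = 1 - (- u) * x" unfolding u by simp
  moreover obtain v where "v * (1 - (- u) * x) = 1"
    using jacobson_radical_left_inverse[OF jacobson_radical_mult_left[OF x]] by blast
  ultimately have v: "v * u = 1" by (rule ssubst)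
  have "v = (v * u) * (1 - x)" by (simp only: mult.assoc u mult_1_right)
  then have "v = 1 - x" by (simp only: v mult_1_left)
  then have "(1 - x) * u = 1" using v by (rule subst)
  then show ?thesis using u unfolding is_unit_elt_def by metis
qed

lemma telescope_power:
  fixes x :: "'a::{ring, monoid_mult}"
  shows "(1 - x) * (\<Sum>k<n. x ^ k) = 1 - x ^ n"
    and "(\<Sum>k<n. x ^ k) * (1 - x) = 1 - x ^ n"
proof -
  show "(1 - x) * (\<Sum>k<n. x ^ k) = 1 - x ^ n"
    by (induction n) (simp_all add: distrib_left left_diff_distrib)
  show "(\<Sum>k<n. x ^ k) * (1 - x) = 1 - x ^ n"
    by (induction n) (simp_all add: distrib_right, simp add: right_diff_distrib power_commutes)
qed

lemma unit_of_unit_power: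
  fixes x :: "'a::{ring, monoid_mult}"
  assumes "is_unit_elt (1 - x ^ n)"
  shows "is_unit_elt (1 - x)"
proof -
  let ?s = "\<Sum>k<n. x ^ k"
  obtain v where v: "v * (1 - x ^ n) = 1" "(1 - x ^ n) * v = 1"
    using assms unfolding is_unit_elt_def by blast
  have l: "(v * ?s) * (1 - x) = 1" using v(1) telescope_power(2)[where x = x and n = n] by (simp add: mult.assoc)
  have r: "(1 - x) * (?s * v) = 1"
    using v(2) telescope_power(1)[where x = x and n = n] by (simp flip: mult.assoc)
  have "v * ?s = ?s * v" using l r by (metis mult.assoc mult_1_left mult_1_right)
  then show ?thesis using l r unfolding is_unit_elt_def by metis
qed

section \<open>Complex scalars\<close>

lemma scaleC_zero_left: "0 *\<^sub>C x = (0::'a::complex_banach_algebra)"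
  using scaleC_of_real[of 0 x] by simp

lemma scaleC_one: "1 *\<^sub>C x = (x::'a::complex_banach_algebra)"
  using scaleC_of_real[of 1 x] by simp

lemma scaleC_minus_one: "(-1) *\<^sub>C x = - (x::'a::complex_banach_algebra)"
  using scaleC_of_real[of "-1" x] by simp

lemma scaleC_power:
  fixes x :: "'a::complex_banach_algebra"
  shows "(c *\<^sub>C x) ^ n = c ^ n *\<^sub>C x ^ n"
  by (induction n) (simp_all add: scaleC_one scaleC_mult_left scaleC_mult_right scaleC_scaleC mult.commute)

lemma scaleC_sum_left:
  fixes x :: "'a::complex_banach_algebra"
  shows "(\<Sum>i<n. f i) *\<^sub>C x = (\<Sum>i<(n::nat). f i *\<^sub>C x)"
  by (induction n) (simp_all add: scaleC_zero_left scaleC_add_left)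

lemma scaleC_diff_left:
  fixes x :: "'a::complex_banach_algebra"
  shows "(c - d) *\<^sub>C x = c *\<^sub>C x - d *\<^sub>C x"
  using scaleC_add_left[of "c - d" d x] by (simp add: algebra_simps)

text \<open>
  The scalar multiple \<open>cw\<close> has a power in \<open>J\<close> along with \<open>w\<close>, because scaling by \<open>c\<close> is left
  multiplication by \<open>c1\<close>.
\<close>

lemma sqrt_jacobson_resolvent:
  fixes w :: "'a::complex_banach_algebra"
  assumes "w \<in> sqrt_jacobson"
  shows "is_unit_elt (1 - c *\<^sub>C w)"
proof -
  obtain m where m: "w ^ m \<in> jacobson_radical" using assms unfolding sqrt_jacobson_def by blast
  have "(c *\<^sub>C w) ^ m = (c ^ m *\<^sub>C 1) * w ^ m" by (simp add: scaleC_power scaleC_mult_left)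
  then have "(c *\<^sub>C w) ^ m \<in> jacobson_radical" using jacobson_radical_mult_left[OF m] by simp
  then show ?thesis by (rule unit_of_unit_power[OF jacobson_radical_unit])
qed

lemma sqrt_jacobson_one_plus_unit:
  fixes w :: "'a::complex_banach_algebra"
  assumes "w \<in> sqrt_jacobson"
  shows "is_unit_elt (1 + w)"
  using sqrt_jacobson_resolvent[OF assms, of "-1"] by (simp add: scaleC_minus_one)

section \<open>Entire resolvent implies quasinilpotent\<close>

lemma sum_root_of_unity_powers:
  fixes n k :: nat
  assumes "k < n"
  defines "\<omega> \<equiv> exp (2 * of_real pi * \<i> / of_nat n)"
  shows "(\<Sum>i<n. (\<omega> ^ i) ^ k) = (if k = 0 then of_nat n else 0)"
proof (cases "k = 0")
  case False
  have n: "n \<noteq> 0" using assms by simp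
  have eq: "\<omega> ^ j = exp (2 * of_real pi * \<i> * of_nat j / of_nat n)" for j
    unfolding \<omega>_def exp_of_nat_mult[symmetric] by (rule arg_cong[of _ _ exp]) simp
  have "\<omega> ^ k \<noteq> 1"
    using complex_root_unity_eq_1[of n k] n False assms(1) by (simp add: eq nat_dvd_not_less)
  moreover have "(\<omega> ^ k) ^ n = 1" using complex_root_unity[OF n, of k] by (simp add: eq)
  ultimately have "(\<Sum>i<n. (\<omega> ^ k) ^ i) = 0" by (simp add: geometric_sum)
  moreover have "(\<omega> ^ i) ^ k = (\<omega> ^ k) ^ i" for i
    by (metis mult.commute power_mult)
  ultimately show ?thesis using False by simp
qed simp

text \<open>
  This is the partial fraction expansion of \<open>1/(1 - t\<^sup>n)\<close> over the \<open>n\<close>-th roots of unity.  Dividing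
  \<open>1 - c\<^sup>n x\<^sup>n\<close> by \<open>1 - c \<omega>\<^sup>i x\<close> leaves a geometric sum, and summing over \<open>i\<close> kills all its terms
  but the constant one.
\<close>

lemma resolvent_average:
  fixes x :: "'a::complex_banach_algebra" and n :: nat
  assumes n: "n > 0" and Qr: "\<And>c. (1 - c *\<^sub>C x) * Q c = 1"
  defines "\<omega> \<equiv> exp (2 * of_real pi * \<i> / of_nat n)"
  shows "(1 - (c *\<^sub>C x) ^ n) * (inverse (real n) *\<^sub>R (\<Sum>i<n. Q (c * \<omega> ^ i))) = 1"
proof -
  have root: "(\<omega> ^ i) ^ n = 1" for i
  proof -
    have "\<omega> ^ n = 1" using complex_root_unity[of n 1] n by (simp add: \<omega>_def)
    then have "(\<omega> ^ n) ^ i = 1" by simp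
    then show ?thesis by (simp only: mult.commute flip: power_mult)
  qed
  have each: "(1 - (c *\<^sub>C x) ^ n) * Q (c * \<omega> ^ i) = (\<Sum>k<n. (\<omega> ^ i) ^ k *\<^sub>C (c *\<^sub>C x) ^ k)" for i
  proof -
    let ?d = "c * \<omega> ^ i"
    have "(c *\<^sub>C x) ^ n = (?d *\<^sub>C x) ^ n" by (simp add: scaleC_power power_mult_distrib root)
    then have "(1 - (c *\<^sub>C x) ^ n) * Q ?d = (\<Sum>k<n. (?d *\<^sub>C x) ^ k) * ((1 - ?d *\<^sub>C x) * Q ?d)"
      by (simp only: telescope_power(2) flip: mult.assoc)
    also have "\<dots> = (\<Sum>k<n. (\<omega> ^ i) ^ k *\<^sub>C (c *\<^sub>C x) ^ k)"
      by (simp add: Qr scaleC_power scaleC_scaleC power_mult_distrib mult_ac)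
    finally show ?thesis .
  qed
  have "(1 - (c *\<^sub>C x) ^ n) * (\<Sum>i<n. Q (c * \<omega> ^ i)) =
      (\<Sum>i<n. \<Sum>k<n. (\<omega> ^ i) ^ k *\<^sub>C (c *\<^sub>C x) ^ k)"
    by (simp add: sum_distrib_left each)
  also have "\<dots> = (\<Sum>k<n. (\<Sum>i<n. (\<omega> ^ i) ^ k) *\<^sub>C (c *\<^sub>C x) ^ k)"
    by (subst sum.swap) (simp add: scaleC_sum_left)
  also have "\<dots> = (\<Sum>k<n. if k = 0 then real n *\<^sub>R 1 else 0)"
    using scaleC_of_real[of "real n" "1::'a"]
    by (intro sum.cong refl)
       (simp add: \<omega>_def sum_root_of_unity_powers scaleC_zero_left)
  also have "\<dots> = real n *\<^sub>R 1" using n by simp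
  finally show ?thesis using n by simp
qed

lemma resolvent_identity:
  fixes x :: "'a::complex_banach_algebra"
  assumes Ql: "\<And>c. Q c * (1 - c *\<^sub>C x) = 1" and Qr: "\<And>c. (1 - c *\<^sub>C x) * Q c = 1"
  shows "Q c - Q d = (c - d) *\<^sub>C (Q c * x * Q d)"
proof -
  have "Q c - Q d = Q c * ((1 - d *\<^sub>C x) * Q d) - (Q c * (1 - c *\<^sub>C x)) * Q d"
    by (simp add: Ql Qr)
  also have "\<dots> = Q c * (c *\<^sub>C x - d *\<^sub>C x) * Q d" by (simp add: algebra_simps)
  also have "\<dots> = (c - d) *\<^sub>C (Q c * x * Q d)"
    by (simp add: scaleC_mult_left scaleC_mult_right flip: scaleC_diff_left)
  finally show ?thesis .
qed

text \<open>
  The resolvent is continuous, hence bounded on the compact disc.  Near \<open>d\<close> the resolvent identity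
  first gives \<open>\<parallel>Q c\<parallel> \<le> 2\<parallel>Q d\<parallel>\<close>, and with this bound it then gives continuity at \<open>d\<close>.
\<close>

lemma resolvent_bounded:
  fixes x :: "'a::complex_banach_algebra"
  assumes Ql: "\<And>c. Q c * (1 - c *\<^sub>C x) = 1" and Qr: "\<And>c. (1 - c *\<^sub>C x) * Q c = 1"
  shows "\<exists>M>0. \<forall>c. cmod c \<le> R \<longrightarrow> norm (Q c) \<le> M"
proof -
  note id = resolvent_identity[OF Ql Qr]
  have le: "norm (Q c - Q d) \<le> cmod (c - d) * (norm (Q c) * norm x * norm (Q d))" for c d
    unfolding id norm_scaleC
    by (intro mult_left_mono order.trans[OF norm_mult_ineq] mult_right_mono norm_mult_ineq) auto
  have "continuous_on UNIV Q"
    unfolding continuous_on_eq_continuous_at[OF open_UNIV]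
  proof
    fix d
    have ev: "\<forall>\<^sub>F c in at d. cmod (c - d) * (norm x * norm (Q d)) < 1/2"
    proof (rule order_tendstoD(2))
      show "((\<lambda>c. cmod (c - d) * (norm x * norm (Q d))) \<longlongrightarrow> cmod (d - d) * (norm x * norm (Q d))) (at d)"
        by (intro tendsto_intros)
    qed simp
    have "\<forall>\<^sub>F c in at d. norm (Q c - Q d) \<le> cmod (c - d) * (2 * norm (Q d) * norm x * norm (Q d))"
      using ev
    proof eventually_elim
      case (elim c)
      have "norm (Q c) \<le> norm (Q d) + norm (Q c - Q d)"
        using norm_triangle_ineq[of "Q d" "Q c - Q d"] by simp
      also have "norm (Q c - Q d) \<le> norm (Q c) * (cmod (c - d) * (norm x * norm (Q d)))"
        using le[of c d] by (simp add: mult_ac)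
      also have "\<dots> \<le> norm (Q c) * (1/2)" using elim by (intro mult_left_mono) auto
      finally have "norm (Q c) \<le> 2 * norm (Q d)" by simp
      then show ?case
        by (intro order.trans[OF le] mult_left_mono mult_right_mono) auto
    qed
    moreover have "((\<lambda>c. cmod (c - d) * (2 * norm (Q d) * norm x * norm (Q d))) \<longlongrightarrow>
        cmod (d - d) * (2 * norm (Q d) * norm x * norm (Q d))) (at d)"
      by (intro tendsto_intros)
    then have "((\<lambda>c. cmod (c - d) * (2 * norm (Q d) * norm x * norm (Q d))) \<longlongrightarrow> 0) (at d)"
      by simp
    ultimately have "((\<lambda>c. Q c - Q d) \<longlongrightarrow> 0) (at d)"
      by (rule Lim_null_comparison)
    then show "isCont Q d" by (simp add: isCont_def LIM_zero_iff)
  qed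
  then have "compact (Q ` cball 0 R)"
    by (intro compact_continuous_image) (auto intro: continuous_on_subset)
  then obtain M where M: "M > 0" "\<And>y. y \<in> Q ` cball 0 R \<Longrightarrow> norm y \<le> M"
    using compact_imp_bounded bounded_pos by metis
  have "\<forall>c. cmod c \<le> R \<longrightarrow> norm (Q c) \<le> M" using M(2) by simp
  then show "\<exists>M>0. \<forall>c. cmod c \<le> R \<longrightarrow> norm (Q c) \<le> M" using M(1) by blast
qed

text \<open>
  With \<open>T n r = (1 - r\<^sup>n x\<^sup>n)\<^sup>-\<^sup>1\<close>, convergence \<open>r\<^sup>n x\<^sup>n \<rightarrow> 0\<close> means \<open>T n r \<rightarrow> 1\<close>.  As averages of
  the resolvent, the maps \<open>T n\<close> have a Lipschitz constant independent of \<open>n\<close>, so for \<open>s\<close> slightly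
  larger than \<open>r\<close> the element \<open>T n s\<close> stays close to \<open>1\<close>, which bounds \<open>s\<^sup>n x\<^sup>n\<close> by \<open>1/2\<close> for
  large \<open>n\<close>; at any radius below \<open>s\<close> there is then convergence to zero.  The admissible increment
  does not depend on \<open>r\<close>, so finitely many steps lead from radius \<open>0\<close> to \<open>R\<close>.
\<close>

lemma quasinilpotent_if_resolvent_entire:
  fixes x :: "'a::complex_banach_algebra"
  assumes unit: "\<And>c. is_unit_elt (1 - c *\<^sub>C x)" and R: "R > 0"
  shows "(\<lambda>n. R ^ n * norm (x ^ n)) \<longlonglongrightarrow> 0"
proof -
  obtain Q where Ql: "\<And>c. Q c * (1 - c *\<^sub>C x) = 1" and Qr: "\<And>c. (1 - c *\<^sub>C x) * Q c = 1"
    using unit unfolding is_unit_elt_def by metis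
  \<comment> \<open>The disc of radius \<open>2R\<close> leaves room for the auxiliary radius \<open>s\<close>, which may exceed \<open>R\<close>.\<close>
  obtain M where M: "M > 0" "\<And>c. cmod c \<le> 2 * R \<Longrightarrow> norm (Q c) \<le> M"
    using resolvent_bounded[OF Ql Qr, of "2 * R"] by auto
  define \<omega> where "\<omega> n = exp (2 * of_real pi * \<i> / of_nat n)" for n :: nat
  define T where "T n r = inverse (real n) *\<^sub>R (\<Sum>i<n. Q (of_real r * \<omega> n ^ i))" for n r
  define y where "y n r = (r *\<^sub>R x) ^ n" for n r
  have \<omega>1: "cmod (\<omega> n ^ i) = 1" for n i by (simp add: \<omega>_def norm_power)
  have avg: "(1 - y n r) * T n r = 1" if "n > 0" for n r
    using resolvent_average[OF that Qr, of "of_real r"]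
    unfolding T_def y_def \<omega>_def by (simp add: scaleC_of_real)
  have mean_le: "norm (inverse (real n) *\<^sub>R (\<Sum>i<n. f i)) \<le> B"
    if "n > 0" "\<And>i. norm (f i) \<le> B" for n and f :: "nat \<Rightarrow> 'a" and B
  proof -
    have "norm (\<Sum>i<n. f i) \<le> real n * B"
      using sum_norm_le[of "{..<n}" f "\<lambda>_. B"] that(2) by simp
    then show ?thesis using that(1) by (simp add: field_simps)
  qed
  define L where "L = M * norm x * M"
  have Qb: "norm (Q (of_real r * \<omega> n ^ i)) \<le> M" if "0 \<le> r" "r \<le> 2 * R" for n i r
    using that by (intro M(2)) (simp add: norm_mult \<omega>1)
  have Tb: "norm (T n r) \<le> M" if "n > 0" "0 \<le> r" "r \<le> 2 * R" for n r
    unfolding T_def by (rule mean_le[OF that(1) Qb[OF that(2,3)]])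
  have TL: "norm (T n s - T n r) \<le> \<bar>s - r\<bar> * L"
    if "n > 0" "0 \<le> r" "r \<le> 2 * R" "0 \<le> s" "s \<le> 2 * R" for n r s
  proof -
    have "norm (Q (of_real s * \<omega> n ^ i) - Q (of_real r * \<omega> n ^ i)) \<le> \<bar>s - r\<bar> * L" for i
    proof -
      have "cmod (of_real s * \<omega> n ^ i - of_real r * \<omega> n ^ i) = \<bar>s - r\<bar>"
        by (simp add: norm_mult \<omega>1 flip: left_diff_distrib of_real_diff)
      moreover have "norm (Q (of_real s * \<omega> n ^ i) * x * Q (of_real r * \<omega> n ^ i)) \<le> L"
        unfolding L_def
        by (intro order.trans[OF norm_mult_ineq] mult_mono Qb[OF that(4,5)] Qb[OF that(2,3)])
           (use M(1) in auto)
      ultimately show ?thesis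
        unfolding resolvent_identity[OF Ql Qr] norm_scaleC by (simp add: mult_left_mono)
    qed
    then have "norm (inverse (real n) *\<^sub>R
        (\<Sum>i<n. Q (of_real s * \<omega> n ^ i) - Q (of_real r * \<omega> n ^ i))) \<le> \<bar>s - r\<bar> * L"
      using that(1) by (intro mean_le)
    then show ?thesis by (simp add: T_def sum_subtractf scaleR_diff_right)
  qed
  \<comment> \<open>The step \<open>\<delta> = R/N\<close> is so small that moving by \<open>2\<delta>\<close> changes \<open>T n\<close> by less than \<open>1/4\<close>.\<close>
  obtain N :: nat where N: "N > 0" "8 * R * L < real N"
  proof -
    obtain N0 :: nat where "8 * R * L < real N0" using reals_Archimedean2 by blast
    then show thesis by (intro that[of "Suc N0"]) auto
  qed
  define \<delta> where "\<delta> = R / real N"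
  have \<delta>: "\<delta> > 0" "2 * \<delta> * L < 1/4" "real N * \<delta> = R"
    using N R by (auto simp: \<delta>_def field_simps)
  have "(\<lambda>n. y n (real k * \<delta>)) \<longlonglongrightarrow> 0" if "k \<le> N" for k
    using that
  proof (induction k)
    case 0
    have "\<forall>\<^sub>F n in sequentially. y n (real 0 * \<delta>) = 0"
      using eventually_gt_at_top[of 0]
      by eventually_elim (auto simp: y_def gr0_conv_Suc)
    then show ?case by (rule tendsto_eventually)
  next
    case (Suc k)
    define r where "r = real k * \<delta>"
    define t where "t = real (Suc k) * \<delta>"
    \<comment> \<open>Overshooting to \<open>s > t\<close> turns the bound \<open>1/2\<close> at \<open>s\<close> into decay like \<open>(t/s)\<^sup>n\<close> at \<open>t\<close>.\<close>
    define s where "s = (real k + 2) * \<delta>"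
    have IH: "(\<lambda>n. y n r) \<longlonglongrightarrow> 0" using Suc unfolding r_def by simp
    have "s \<le> (2 * real N) * \<delta>"
      unfolding s_def using Suc.prems N(1) \<delta>(1) by (intro mult_right_mono) auto
    then have s2R: "s \<le> 2 * R" using \<delta>(3) by (simp add: mult.assoc)
    have rst: "0 \<le> r" "r < t" "t < s" "s - r = 2 * \<delta>" "0 < t"
      using \<delta>(1) by (auto simp: r_def s_def t_def algebra_simps add_pos_nonneg)
    have "(\<lambda>n. norm (y n r) * M) \<longlonglongrightarrow> 0"
      using tendsto_mult_right[OF tendsto_norm[OF IH], of M] by simp
    \<comment> \<open>\<open>1/12 + 1/4 = 1/3\<close>, and \<open>\<parallel>T - 1\<parallel> \<le> 1/3\<close> yields \<open>\<parallel>y\<parallel> \<le> 1/2\<close> below.\<close>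
    then have ev: "\<forall>\<^sub>F n in sequentially. norm (y n r) * M < 1/12"
      by (rule order_tendstoD(2)) simp
    have half: "\<forall>\<^sub>F n in sequentially. norm (y n s) \<le> 1/2"
      using ev eventually_gt_at_top[of 0]
    proof eventually_elim
      case (elim n)
      have idr: "T n q - 1 = y n q * T n q" for q
      proof -
        have "T n q - 1 = T n q - (1 - y n q) * T n q" by (simp only: avg[OF elim(2)])
        then show ?thesis by (simp add: left_diff_distrib)
      qed
      have "norm (T n r - 1) \<le> norm (y n r) * norm (T n r)" unfolding idr by (rule norm_mult_ineq)
      also have "\<dots> \<le> norm (y n r) * M"
        using Tb[of n r] elim(2) rst s2R by (intro mult_left_mono) auto
      finally have 1: "norm (T n r - 1) \<le> 1/12" using elim(1) by simp
      have 2: "norm (T n s - T n r) \<le> 1/4"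
        using TL[of n r s] elim(2) rst s2R \<delta>(1,2) by auto
      have 3: "norm (T n s - 1) \<le> 1/3"
        using norm_triangle_ineq[of "T n s - T n r" "T n r - 1"] 1 2 by simp
      have "y n s = (T n s - 1) - y n s * (T n s - 1)"
        by (simp add: right_diff_distrib flip: idr)
      then have "norm (y n s) \<le> norm (T n s - 1) + norm (y n s * (T n s - 1))"
        by (metis norm_triangle_ineq4)
      also have "\<dots> \<le> 1/3 + norm (y n s) * (1/3)"
        using 3 by (intro add_mono order.trans[OF norm_mult_ineq] mult_left_mono) auto
      finally show ?case by simp
    qed
    have pow: "y n q = q ^ n *\<^sub>R x ^ n" for n q
      using scaleC_power[of "of_real q" x n] by (simp add: y_def scaleC_of_real flip: of_real_power)
    have "\<forall>\<^sub>F n in sequentially. norm (y n t) \<le> (t / s) ^ n"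
      using half
    proof eventually_elim
      case (elim n)
      have "y n t = (t / s) ^ n *\<^sub>R y n s" using rst by (simp add: pow power_divide)
      then have "norm (y n t) = (t / s) ^ n * norm (y n s)" using rst by simp
      also have "\<dots> \<le> (t / s) ^ n * 1" using elim rst by (intro mult_left_mono) auto
      finally show ?case by simp
    qed
    moreover have "(\<lambda>n. (t / s) ^ n) \<longlonglongrightarrow> 0"
      using rst by (intro LIMSEQ_realpow_zero) auto
    ultimately show ?case unfolding t_def by (rule Lim_null_comparison)
  qed
  from this[of N] have "(\<lambda>n. norm (y n R)) \<longlonglongrightarrow> 0" using \<delta>(3) by (simp add: tendsto_norm_zero)
  moreover have "norm (y n R) = R ^ n * norm (x ^ n)" for n
    using scaleC_power[of "of_real R" x n] R
    by (simp add: y_def scaleC_of_real flip: of_real_power)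
  ultimately show ?thesis by simp
qed

lemma sqrt_jacobson_quasinilpotent:
  fixes w :: "'a::complex_banach_algebra"
  assumes "w \<in> sqrt_jacobson" and "R > 0"
  shows "(\<lambda>n. R ^ n * norm (w ^ n)) \<longlonglongrightarrow> 0"
  using quasinilpotent_if_resolvent_entire sqrt_jacobson_resolvent assms by blast

section \<open>The spectral idempotent and the generalized Zhou inverse\<close>

text \<open>
  The extra factor \<open>t\<close> avoids \<open>\<parallel>d\<^sup>k\<parallel> \<le> \<parallel>d\<parallel>\<^sup>k\<close>, which fails at \<open>k = 0\<close> when \<open>\<parallel>1\<parallel> > 1\<close>.
\<close>

lemma norm_power_mult_le:
  fixes d :: "'a::complex_banach_algebra"
  shows "norm (d ^ k * t) \<le> norm d ^ k * norm t" and "norm (t * d ^ k) \<le> norm t * norm d ^ k"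
proof -
  show "norm (d ^ k * t) \<le> norm d ^ k * norm t"
  proof (induction k)
    case (Suc k)
    have "norm (d ^ Suc k * t) \<le> norm d * norm (d ^ k * t)"
      using norm_mult_ineq[of d "d ^ k * t"] by (simp add: mult.assoc)
    also have "\<dots> \<le> norm d * (norm d ^ k * norm t)" using Suc by (intro mult_left_mono) auto
    finally show ?case by (simp add: mult_ac)
  qed simp
  show "norm (t * d ^ k) \<le> norm t * norm d ^ k"
  proof (induction k)
    case (Suc k)
    have "norm (t * d ^ Suc k) \<le> norm (t * d ^ k) * norm d"
      using norm_mult_ineq[of "t * d ^ k" d] by (simp add: mult.assoc power_commutes)
    also have "\<dots> \<le> (norm t * norm d ^ k) * norm d" using Suc by (intro mult_right_mono) auto
    finally show ?case by (simp add: mult_ac)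
  qed simp
qed

text \<open>
  Iterating the equation gives \<open>\<parallel>z\<parallel> \<le> \<parallel>z\<parallel> \<parallel>d\<parallel>\<^sup>k \<parallel>w\<^sup>k\<parallel>\<close> for every \<open>k\<close>.  The two forms serve
  the two off-diagonal corners of an element with respect to an idempotent.
\<close>

lemma quasinilpotent_intertwining_zero:
  fixes z d w :: "'a::complex_banach_algebra"
  assumes qn: "\<And>R. R > 0 \<Longrightarrow> (\<lambda>n. R ^ n * norm (w ^ n)) \<longlonglongrightarrow> 0"
    and fixpt: "z = d * z * w \<or> z = w * z * d"
  shows "z = 0"
proof -
  have le: "norm z \<le> norm z * (norm d ^ k * norm (w ^ k))" for k
    using fixpt
  proof
    assume z: "z = d * z * w"
    have "z = d ^ k * (z * w ^ k)"
    proof (induction k)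
      case (Suc k)
      have "d ^ Suc k * (z * w ^ Suc k) = d ^ k * ((d * z * w) * w ^ k)"
        by (simp add: mult.assoc power_Suc2 del: power_Suc) (simp add: power_commutes)
      then show ?case using Suc z by simp
    qed simp
    then have "norm z \<le> norm d ^ k * norm (z * w ^ k)" by (metis norm_power_mult_le(1))
    also have "\<dots> \<le> norm d ^ k * (norm z * norm (w ^ k))"
      by (intro mult_left_mono norm_mult_ineq) simp
    finally show ?thesis by (simp add: mult_ac)
  next
    assume z: "z = w * z * d"
    have "z = (w ^ k * z) * d ^ k"
    proof (induction k)
      case (Suc k)
      have "(w ^ Suc k * z) * d ^ Suc k = (w ^ k * (w * z * d)) * d ^ k"
        by (simp add: mult.assoc power_Suc2 del: power_Suc) (simp add: power_commutes)
      then show ?case using Suc z by simp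
    qed simp
    then have "norm z \<le> norm (w ^ k * z) * norm d ^ k" by (metis norm_power_mult_le(2))
    also have "\<dots> \<le> (norm (w ^ k) * norm z) * norm d ^ k"
      by (intro mult_right_mono norm_mult_ineq) simp
    finally show ?thesis by (simp add: mult_ac)
  qed
  \<comment> \<open>\<open>\<parallel>d\<parallel> + 1\<close> in place of \<open>\<parallel>d\<parallel>\<close> makes the radius in \<open>qn\<close> positive even if \<open>d = 0\<close>.\<close>
  have "norm z \<le> norm z * ((norm d + 1) ^ k * norm (w ^ k))" for k
    by (intro order.trans[OF le[of k]] mult_left_mono mult_right_mono power_mono) auto
  moreover have "(\<lambda>k. norm z * ((norm d + 1) ^ k * norm (w ^ k))) \<longlonglongrightarrow> norm z * 0"
    by (intro tendsto_mult_left qn) (simp add: add_nonneg_pos)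
  ultimately have "norm z \<le> norm z * 0" by (intro LIMSEQ_le_const) auto
  then show ?thesis by simp
qed

lemma commute_power:
  fixes x y :: "'a::monoid_mult"
  assumes "x * y = y * x"
  shows "x ^ n * y = y * x ^ n"
  by (induction n) (simp_all add: mult.assoc assms, simp add: assms flip: mult.assoc)

lemma commute_inverse:
  fixes x y :: "'a::monoid_mult"
  assumes "v * x = 1" "x * v = 1" "x * y = y * x"
  shows "v * y = y * v"
proof -
  have "v * y = v * (y * x) * v" using assms(2) by (simp add: mult.assoc)
  also have "\<dots> = (v * x) * y * v" by (simp add: mult.assoc flip: assms(3))
  finally show ?thesis using assms(1) by simp
qed

lemma idempotent_commute_if_corners_zero:
  fixes p y :: "'a::{ring, monoid_mult}"
  assumes "p * y * (1 - p) = 0" "(1 - p) * y * p = 0"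
  shows "p * y = y * p"
proof -
  have "p * y - p * y * p = 0" using assms(1) by (simp only: right_diff_distrib mult_1_right)
  moreover have "y * p - p * y * p = 0" using assms(2) by (simp only: left_diff_distrib mult_1_left)
  ultimately show ?thesis by simp
qed

text \<open>
  Relative to \<open>1 = p + (1 - p)\<close>, the element \<open>c\<close> is block diagonal: invertible on the \<open>p\<close>-block, with
  inverse \<open>v p\<close>, and equal to the quasinilpotent \<open>w\<close> on the other.  An element commuting with \<open>c\<close>
  intertwines the two blocks through its off-diagonal corners, which must therefore vanish.
\<close>

lemma spectral_idempotent_commute:
  fixes c p y :: "'a::complex_banach_algebra"
  assumes pp: "p * p = p" and pc: "p * c = c * p"
    and w: "c - p \<in> sqrt_jacobson" and yc: "y * c = c * y"
  shows "p * y = y * p"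
proof -
  define w where "w = c - p"
  have c: "c = p + w" by (simp add: w_def)
  have pw: "p * w = w * p" using pc by (simp add: w_def algebra_simps)
  have qn: "(\<lambda>n. R ^ n * norm (w ^ n)) \<longlonglongrightarrow> 0" if "R > 0" for R
    using sqrt_jacobson_quasinilpotent[OF w that] by (simp add: w_def)
  obtain v where v: "v * (1 + w) = 1" "(1 + w) * v = 1"
    using sqrt_jacobson_one_plus_unit[OF w] unfolding is_unit_elt_def w_def by blast
  have vp: "v * p = p * v" by (rule commute_inverse[OF v]) (simp add: algebra_simps pw)
  have c1: "p * c = p * (1 + w)" by (simp add: c algebra_simps pp)
  have cp: "c * p = (1 + w) * p" by (simp add: c algebra_simps pp)
  have dc: "(v * p) * c = p"
  proof -
    have "(v * p) * c = v * (c * p)" by (simp add: mult.assoc pc)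
    also have "\<dots> = p" using v(1) by (simp add: cp flip: mult.assoc)
    finally show ?thesis .
  qed
  have cd: "c * (v * p) = p"
  proof -
    have "c * (v * p) = (p * c) * v" by (simp only: vp pc mult.assoc)
    also have "\<dots> = p * ((1 + w) * v)" by (simp only: c1 mult.assoc)
    also have "\<dots> = p" by (simp only: v(2) mult_1_right)
    finally show ?thesis .
  qed
  have cq: "c * (1 - p) = (1 - p) * w" "(1 - p) * c = w * (1 - p)"
    by (simp_all add: c algebra_simps pp pw)
  have "p * y * (1 - p) = 0"
  proof (rule quasinilpotent_intertwining_zero[OF qn])
    have "p * y * (1 - p) = (v * p) * (c * p * y) * (1 - p)"
      by (simp only: dc pp flip: mult.assoc)
    also have "c * p * y = p * (y * c)" by (simp only: yc mult.assoc flip: pc)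
    also have "(v * p) * (p * (y * c)) * (1 - p) = (v * p) * (p * y) * (c * (1 - p))"
      by (simp only: mult.assoc)
    also have "\<dots> = (v * p) * (p * y * (1 - p)) * w" by (simp only: cq mult.assoc)
    finally show "p * y * (1 - p) = (v * p) * (p * y * (1 - p)) * w \<or>
        p * y * (1 - p) = w * (p * y * (1 - p)) * (v * p)" by blast
  qed
  moreover have "(1 - p) * y * p = 0"
  proof (rule quasinilpotent_intertwining_zero[OF qn])
    have "(1 - p) * y * p = (1 - p) * y * (p * (c * (v * p)))" by (simp only: cd pp)
    also have "\<dots> = (1 - p) * y * ((p * c) * (v * p))" by (simp only: mult.assoc)
    also have "\<dots> = (1 - p) * (y * c) * p * (v * p)" by (simp only: pc mult.assoc)
    also have "\<dots> = ((1 - p) * c) * y * p * (v * p)" by (simp only: yc mult.assoc)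
    also have "\<dots> = w * ((1 - p) * y * p) * (v * p)" by (simp only: cq mult.assoc)
    finally show "(1 - p) * y * p = (v * p) * ((1 - p) * y * p) * w \<or>
        (1 - p) * y * p = w * ((1 - p) * y * p) * (v * p)" by blast
  qed
  ultimately show ?thesis by (rule idempotent_commute_if_corners_zero)
qed

text \<open>
  The inverse of \<open>a\<close> on the \<open>p\<close>-block is \<open>a\<^sup>n\<^sup>-\<^sup>1\<close> times the inverse \<open>v p\<close> of \<open>a\<^sup>n\<close> there, and \<open>b\<close> is
  this element, extended by zero.  Everything commuting with \<open>a\<close> commutes with \<open>a\<^sup>n\<close>, then with
  \<open>p\<close>, then with \<open>v\<close>, and so with \<open>b\<close>.
\<close>

lemma generalized_Zhou_inverse_of_idempotent:
  fixes a p :: "'a::complex_banach_algebra"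
  assumes pp: "p * p = p" and pa: "p * a = a * p" and n: "n \<ge> 1"
    and w: "a ^ n - p \<in> sqrt_jacobson"
  shows "has_generalized_Zhou_inverse a"
proof -
  define u where "u = 1 + (a ^ n - p)"
  obtain v where v: "v * u = 1" "u * v = 1"
    using sqrt_jacobson_one_plus_unit[OF w] unfolding is_unit_elt_def u_def by blast
  define b where "b = a ^ (n - 1) * p * v"
  have apn: "a ^ n * p = p * a ^ n" by (rule commute_power) (simp add: pa)
  have an: "a * a ^ (n - 1) = a ^ n" using n by (simp flip: power_Suc)
  have "a * b = (a ^ n * p) * v" by (simp only: b_def an flip: mult.assoc)
  also have "a ^ n * p = p * u" by (simp add: u_def distrib_left right_diff_distrib pp apn)
  also have "p * u * v = p" using v(2) by (simp add: mult.assoc)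
  finally have ab: "a * b = p" .
  have comm_b: "b * y = y * b" if y: "y * a = a * y" for y
  proof -
    have yan: "a ^ k * y = y * a ^ k" for k by (rule commute_power) (simp add: y)
    have py: "p * y = y * p"
      by (rule spectral_idempotent_commute[OF pp apn[symmetric] w yan[symmetric]])
    have vy: "v * y = y * v"
      by (rule commute_inverse[OF v]) (simp add: u_def algebra_simps yan py)
    have "b * y = a ^ (n - 1) * (p * y) * v" by (simp only: b_def vy mult.assoc)
    also have "\<dots> = (a ^ (n - 1) * y) * p * v" by (simp only: py mult.assoc)
    also have "\<dots> = y * b" by (simp only: b_def yan mult.assoc)
    finally show ?thesis .
  qed
  have ba: "b * a = a * b" using comm_b[of a] by simp
  have "a ^ (n - 1) * p = p * a ^ (n - 1)" by (rule commute_power) (simp add: pa)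
  then have pb: "p * b = b" by (simp only: b_def pp flip: mult.assoc)
  have "b = b * a * b" by (simp only: ba ab pb)
  moreover have "b \<in> comm2 a" using comm_b unfolding comm2_def comm_def by blast
  moreover have "a ^ n - a * b \<in> sqrt_jacobson" using w ab by simp
  ultimately show ?thesis using n unfolding has_generalized_Zhou_inverse_def by blast
qed

theorem lemma2p8:
  fixes a :: "'a::complex_banach_algebra"
  shows "(has_generalized_Zhou_inverse a \<longleftrightarrow>
           (\<exists>b::'a. b = b * a * b \<and> b * a = a * b \<and>
              (\<exists>n::nat. n \<ge> 1 \<and> a ^ n - a * b \<in> sqrt_jacobson)))
       \<and> ((\<exists>b::'a. b = b * a * b \<and> b * a = a * b \<and>
              (\<exists>n::nat. n \<ge> 1 \<and> a ^ n - a * b \<in> sqrt_jacobson)) \<longleftrightarrow>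
           (\<exists>p::'a. p * p = p \<and> p * a = a * p \<and>
              (\<exists>n::nat. n \<ge> 1 \<and> a ^ n - p \<in> sqrt_jacobson)))"
    (is "(?one \<longleftrightarrow> ?two) \<and> (?two \<longleftrightarrow> ?three)")
proof -
  have "?one \<Longrightarrow> ?two"
    unfolding has_generalized_Zhou_inverse_def comm2_def comm_def by blast
  moreover have "?three" if ?two
    using that
  proof (elim exE conjE)
    fix b and n :: nat
    assume b: "b = b * a * b" "b * a = a * b"
      and n: "n \<ge> 1" "a ^ n - a * b \<in> sqrt_jacobson"
    have "(a * b) * (a * b) = a * (b * a * b)" by (simp only: mult.assoc)
    then have "(a * b) * (a * b) = a * b" by (simp only: b(1)[symmetric])
    moreover have "(a * b) * a = a * (a * b)" by (simp only: mult.assoc b(2))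
    ultimately show ?thesis using n by blast
  qed
  moreover have "?three \<Longrightarrow> ?one" using generalized_Zhou_inverse_of_idempotent by blast
  ultimately show ?thesis by blast
qed

end
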